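(* Assume objective regularity, i.e. $\nabla f,\nabla g$ are jointly Lipschitz in $(x,y)$ with constants $\ell_{f,1},\ell_{g,1}$; for every $x$, $g(x,\cdot)$ is $\rho_g$-strongly convex for some $\rho_g>0$; $f,g\in C^2$ with $\nabla^2f,\nabla^2g$ jointly Lipschitz in $(x,y)$ with constants $\ell_{f,2},\ell_{g,2}$; and for all $(x,y)$, $\|\nabla_xf(x,y)\|_2\le\ell_{f,0}$, $\|\nabla_yf(x,y)\|_2\le\ell_{f,0}$ and $\|\nabla_xg(x,y)\|_2\le\ell_{g,0}$. Let $\mu>0$, and fix $\eta\in(0,1/2)$. Then there exist a finite threshold $\lambda_\eta$ and finite constants $\rho_\psi^\eta,\rho_{\psi,\lambda}^\eta>0$ and $\ell_{\psi,1}^\eta,\ell_{\psi,2}^\eta,\ell_{\psi,\lambda,1}^\eta,\ell_{\psi,\lambda,2}^\eta,\ell_{f,0}^\eta,\ell_{f,1}^\eta,\ell_{f,2}^\eta<\infty$ such that for every $x\in\mathbb R^{d_x}$, writing $c=y_\mu^\star(x)$, the following hold. (i) For all $y\in T_{\eta,\mu}(x)$: $\rho_\psi^\eta H_c\preceq\nabla^2_{yy}\psi_\mu(x,y)\preceq\ell_{\psi,1}^\eta H_c$ and $\|\nabla^2_{xy}\psi_\mu(x,y)\|_{2\to c,*}\le\ell_{\psi,1}^\eta$; and for all $y_1,y_2\in T_{\eta,\mu}(x)$: $\|\nabla^2_{yy}\psi_\mu(x,y_1)-\nabla^2_{yy}\psi_\mu(x,y_2)\|_{c\to c,*}\le\ell_{\psi,2}^\eta\|y_1-y_2\|_c$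 and $\|\nabla^2_{xy}\psi_\mu(x,y_1)-\nabla^2_{xy}\psi_\mu(x,y_2)\|_{2\to c,*}\le\ell_{\psi,2}^\eta\|y_1-y_2\|_c$. (ii) For all $y\in T_{\eta,\mu}(x)$: $\|\nabla_yf(x,y)\|_{c,*}\le\ell_{f,0}^\eta$, $\|\nabla^2_{xy}f(x,y)\|_{2\to c,*}\le\ell_{f,1}^\eta$, $\|\nabla^2_{yy}f(x,y)\|_{c\to c,*}\le\ell_{f,1}^\eta$; and for all $y_1,y_2\in T_{\eta,\mu}(x)$: $\|\nabla^2_{xy}f(x,y_1)-\nabla^2_{xy}f(x,y_2)\|_{2\to c,*}\le\ell_{f,2}^\eta\|y_1-y_2\|_c$ and $\|\nabla^2_{yy}f(x,y_1)-\nabla^2_{yy}f(x,y_2)\|_{c\to c,*}\le\ell_{f,2}^\eta\|y_1-y_2\|_c$. (iii) For every $\lambda\ge\lambda_\eta$, writing $c_\lambda=y^\star_{\lambda,\mu}(x)$: for all $y\in T^\lambda_{\eta,\mu}(x)$, $\rho_{\psi,\lambda}^\eta H_{c_\lambda}\preceq\nabla^2_{yy}\psi_\mu(x,y)\preceq\ell_{\psi,\lambda,1}^\eta H_{c_\lambda}$ and $\|\nabla^2_{xy}\psi_\mu(x,y)\|_{2\to c_\lambda,*}\le\ell_{\psi,\lambda,1}^\eta$; and for all $y_1,y_2\in T^\lambda_{\eta,\mu}(x)$, $\|\nabla^2_{yy}\psi_\mu(x,y_1)-\nabla^2_{yy}\psi_\mu(x,y_2)\|_{c_\lambda\to c_\lambda,*}\le\ell_{\psi,\lambda,2}^\eta\|y_1-y_2\|_{c_\lambda}$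 and $\|\nabla^2_{xy}\psi_\mu(x,y_1)-\nabla^2_{xy}\psi_\mu(x,y_2)\|_{2\to c_\lambda,*}\le\ell_{\psi,\lambda,2}^\eta\|y_1-y_2\|_{c_\lambda}$.
   Context: Let $Y=\{y\in\mathbb R^{d_y}:Ay\le b\}$ be a compact full-dimensional polytope with nonempty interior, $a_i^\top$ ($i=1,\dots,m$) the rows of $A$, and $f,g:\mathbb R^{d_x}\times\mathbb R^{d_y}\to\mathbb R$. With $y^\star(x)=\arg\min_{y\in Y}g(x,y)$ one assumes $\inf_xf(x,y^\star(x))>-\infty$. Objective regularity: (A1) $\nabla f,\nabla g$ jointly Lipschitz with constants $\ell_{f,1},\ell_{g,1}$; (A2) $g(x,\cdot)$ is $\rho_g$-strongly convex for every $x$, $\rho_g>0$; (A3) $f,g\in C^2$ with $\nabla^2f,\nabla^2g$ jointly Lipschitz with constants $\ell_{f,2},\ell_{g,2}$; (A4) for all $(x,y)$, $\|\nabla_xf\|_2,\|\nabla_yf\|_2\le\ell_{f,0}$ and $\|\nabla_xg\|_2\le\ell_{g,0}$. Barrier objects: $\phi(y)=-\sum_i\log(b_i-a_i^\top y)$ on $\operatorname{int}(Y)$; $\psi_\mu(x,y)=g(x,y)+\mu\phi(y)$; $y_\mu^\star(x)=\arg\min_{y\in\operatorname{int}(Y)}\psi_\mu(x,y)$; $\psi_\mu^\star(x)=\min_{\operatorname{int}(Y)}\psi_\mu(x,\cdot)$; $L_{\lambda,\mu}(x,y)=f(x,y)+\lambda(\psi_\mu(x,y)-\psi_\mu^\star(x))$;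 $y^\star_{\lambda,\mu}(x)\in\arg\min_{y\in\operatorname{int}(Y)}L_{\lambda,\mu}(x,y)$. For $c\in\operatorname{int}(Y)$: $H_c=\nabla^2\phi(c)$, $\|u\|_c^2=\langle H_cu,u\rangle$, $\|w\|_{c,*}^2=\langle H_c^{-1}w,w\rangle$, $\|M\|_{2\to c,*}=\sup_{\|u\|_2=1}\|Mu\|_{c,*}$, $\|M\|_{c\to c,*}=\sup_{\|u\|_c=1}\|Mu\|_{c,*}$. Neighborhoods: $T_{\eta,\mu}(x)=\{y\in\operatorname{int}(Y):\|y-y_\mu^\star(x)\|_{y_\mu^\star(x)}\le\eta\}$, $T^\lambda_{\eta,\mu}(x)=\{y\in\operatorname{int}(Y):\|y-y^\star_{\lambda,\mu}(x)\|_{y^\star_{\lambda,\mu}(x)}\le\eta\}$. $\nabla^2_{xy}h(x,y)\in\mathbb R^{d_y\times d_x}$ is the $x$-derivative of $\nabla_yh$. *)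

theory Defs
  imports "HOL-Analysis.Analysis"
begin

section \<open>Gradients and Hessians\<close>

definition gradient :: "('a::real_inner \<Rightarrow> real) \<Rightarrow> 'a \<Rightarrow> 'a" where
  "gradient h z = (THE D. GDERIV h z :> D)"

text \<open>The joint Hessian on an arbitrary Euclidean space, in particular on the product
  \<open>(real^'p) \<times> (real^'q)\<close>, for which there is no matrix type. It is an element of
  \<open>'a \<Rightarrow>\<^sub>L 'a\<close>, so distances between Hessians are measured in the spectral norm.\<close>

definition hessian :: "('a::euclidean_space \<Rightarrow> real) \<Rightarrow> 'a \<Rightarrow> ('a \<Rightarrow>\<^sub>L 'a)" where
  "hessian h z = Blinfun (frechet_derivative (gradient h) (at z))"

definition twice_continuously_differentiable :: "('a::euclidean_space \<Rightarrow> real) \<Rightarrow> bool" where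
  "twice_continuously_differentiable h \<longleftrightarrow>
     (\<forall>z. h differentiable (at z)) \<and>
     (\<forall>z. gradient h differentiable (at z)) \<and>
     continuous_on UNIV (hessian h)"

definition grad_x :: "((real^'p) \<times> (real^'q) \<Rightarrow> real) \<Rightarrow> real^'p \<Rightarrow> real^'q \<Rightarrow> real^'p" where
  "grad_x h x y = gradient (\<lambda>x'. h (x', y)) x"

definition grad_y :: "((real^'p) \<times> (real^'q) \<Rightarrow> real) \<Rightarrow> real^'p \<Rightarrow> real^'q \<Rightarrow> real^'q" where
  "grad_y h x y = gradient (\<lambda>y'. h (x, y')) y"

definition hess_yy :: "((real^'p) \<times> (real^'q) \<Rightarrow> real) \<Rightarrow> real^'p \<Rightarrow> real^'q \<Rightarrow> real^'q^'q" where
  "hess_yy h x y = jacobian (\<lambda>y'. grad_y h x y') (at y)"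

text \<open>The \<open>x\<close>-derivative of the \<open>y\<close>-gradient, a matrix with \<open>CARD('q)\<close> rows and
  \<open>CARD('p)\<close> columns.\<close>

definition hess_xy :: "((real^'p) \<times> (real^'q) \<Rightarrow> real) \<Rightarrow> real^'p \<Rightarrow> real^'q \<Rightarrow> real^'p^'q" where
  "hess_xy h x y = jacobian (\<lambda>x'. grad_y h x' y) (at x)"

definition strongly_convex :: "real \<Rightarrow> ('a::real_normed_vector \<Rightarrow> real) \<Rightarrow> bool" where
  "strongly_convex \<rho> h \<longleftrightarrow>
     (\<forall>u v. \<forall>t\<in>{0..1}.
        h ((1 - t) *\<^sub>R u + t *\<^sub>R v)
          \<le> (1 - t) * h u + t * h v - \<rho> / 2 * t * (1 - t) * (norm (u - v))\<^sup>2)"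

definition loewner_le :: "real^'n^'n \<Rightarrow> real^'n^'n \<Rightarrow> bool" (infix \<open>\<preceq>\<^sub>L\<close> 50) where
  "M \<preceq>\<^sub>L N \<longleftrightarrow> (\<forall>u. 0 \<le> ((N - M) *v u) \<bullet> u)"


section \<open>Polytope and barrier problem\<close>

text \<open>The order on \<open>real^'m\<close> is componentwise.\<close>

definition feasible :: "real^'q^'m \<Rightarrow> real^'m \<Rightarrow> (real^'q) set" where
  "feasible A b = {y. A *v y \<le> b}"

text \<open>Meaningful on the interior of the feasible set only.\<close>

definition barrier :: "real^'q^'m \<Rightarrow> real^'m \<Rightarrow> real^'q \<Rightarrow> real" where
  "barrier A b y = - (\<Sum>i\<in>UNIV. ln (b $ i - row i A \<bullet> y))"

definition psi ::
  "real^'q^'m \<Rightarrow> real^'m \<Rightarrow> ((real^'p) \<times> (real^'q) \<Rightarrow> real) \<Rightarrow> real \<Rightarrow> (real^'p) \<times> (real^'q) \<Rightarrow> real" where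
  "psi A b g \<mu> = (\<lambda>(x, y). g (x, y) + \<mu> * barrier A b y)"

definition y_star ::
  "real^'q^'m \<Rightarrow> real^'m \<Rightarrow> ((real^'p) \<times> (real^'q) \<Rightarrow> real) \<Rightarrow> real^'p \<Rightarrow> real^'q" where
  "y_star A b g x = arg_min_on (\<lambda>y. g (x, y)) (feasible A b)"

definition y_star_mu ::
  "real^'q^'m \<Rightarrow> real^'m \<Rightarrow> ((real^'p) \<times> (real^'q) \<Rightarrow> real) \<Rightarrow> real \<Rightarrow> real^'p \<Rightarrow> real^'q" where
  "y_star_mu A b g \<mu> x = arg_min_on (\<lambda>y. psi A b g \<mu> (x, y)) (interior (feasible A b))"

definition psi_star ::
  "real^'q^'m \<Rightarrow> real^'m \<Rightarrow> ((real^'p) \<times> (real^'q) \<Rightarrow> real) \<Rightarrow> real \<Rightarrow> real^'p \<Rightarrow> real" where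
  "psi_star A b g \<mu> x = (INF y\<in>interior (feasible A b). psi A b g \<mu> (x, y))"

definition penalty_lagrangian ::
  "real^'q^'m \<Rightarrow> real^'m \<Rightarrow> ((real^'p) \<times> (real^'q) \<Rightarrow> real) \<Rightarrow> ((real^'p) \<times> (real^'q) \<Rightarrow> real)
     \<Rightarrow> real \<Rightarrow> real \<Rightarrow> real^'p \<Rightarrow> real^'q \<Rightarrow> real" where
  "penalty_lagrangian A b f g \<mu> lam x y =
     f (x, y) + lam * (psi A b g \<mu> (x, y) - psi_star A b g \<mu> x)"

text \<open>The set of all minimizers: the penalized problem need not be convex, so a minimizer
  need not be unique.\<close>

definition penalty_minimizers ::
  "real^'q^'m \<Rightarrow> real^'m \<Rightarrow> ((real^'p) \<times> (real^'q) \<Rightarrow> real) \<Rightarrow> ((real^'p) \<times> (real^'q) \<Rightarrow> real)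
     \<Rightarrow> real \<Rightarrow> real \<Rightarrow> real^'p \<Rightarrow> (real^'q) set" where
  "penalty_minimizers A b f g \<mu> lam x =
     {y. is_arg_min (penalty_lagrangian A b f g \<mu> lam x) (\<lambda>y. y \<in> interior (feasible A b)) y}"


section \<open>Local norms\<close>

definition barrier_hess :: "real^'q^'m \<Rightarrow> real^'m \<Rightarrow> real^'q \<Rightarrow> real^'q^'q" where
  "barrier_hess A b c = jacobian (gradient (barrier A b)) (at c)"

definition loc_norm :: "real^'q^'m \<Rightarrow> real^'m \<Rightarrow> real^'q \<Rightarrow> real^'q \<Rightarrow> real" where
  "loc_norm A b c u = sqrt ((barrier_hess A b c *v u) \<bullet> u)"

definition dual_norm :: "real^'q^'m \<Rightarrow> real^'m \<Rightarrow> real^'q \<Rightarrow> real^'q \<Rightarrow> real" where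
  "dual_norm A b c w = sqrt ((matrix_inv (barrier_hess A b c) *v w) \<bullet> w)"

definition opnorm_2 :: "real^'q^'m \<Rightarrow> real^'m \<Rightarrow> real^'q \<Rightarrow> real^'p^'q \<Rightarrow> real" where
  "opnorm_2 A b c M = (SUP u\<in>{u. norm u = 1}. dual_norm A b c (M *v u))"

definition opnorm_c :: "real^'q^'m \<Rightarrow> real^'m \<Rightarrow> real^'q \<Rightarrow> real^'q^'q \<Rightarrow> real" where
  "opnorm_c A b c M = (SUP u\<in>{u. loc_norm A b c u = 1}. dual_norm A b c (M *v u))"

text \<open>The neighbourhood of a point \<open>c\<close>; used with \<open>c\<close> the barrier minimizer and with \<open>c\<close> a
  minimizer of the penalized problem.\<close>

definition nbhd :: "real^'q^'m \<Rightarrow> real^'m \<Rightarrow> real \<Rightarrow> real^'q \<Rightarrow> (real^'q) set" where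
  "nbhd A b \<eta> c = {y \<in> interior (feasible A b). loc_norm A b c (y - c) \<le> \<eta>}"

end

theory Submission
  imports Defs
begin

text \<open>
  All the estimates hold at every centre \<open>c\<close> in the interior of the polytope, with constants
  independent of \<open>c\<close> and \<open>x\<close>. The minimizers of the barrier problem and of the penalized
  problem exist and lie in the interior, because the barrier blows up at the boundary and its
  coefficient is positive (\<open>barrier_minimizer_exists\<close>); so both families of constants can be
  taken equal, and any positive threshold for \<open>\<lambda>\<close> will do.

  The squared local norm at \<open>c\<close> is \<open>\<Sum>i. (a\<^sub>i \<bullet> u / s\<^sub>i)\<^sup>2\<close>, where \<open>s\<^sub>i\<close> is the slack of the
  \<open>i\<close>-th constraint at \<open>c\<close> (\<open>loc_norm_eq\<close>). Two consequences carry the proof. Slacks are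
  bounded on the compact polytope and the rows of \<open>A\<close> span the space, so
  \<open>\<parallel>u\<parallel> \<le> \<kappa> \<parallel>u\<parallel>\<^sub>c\<close> with one \<open>\<kappa>\<close> for all centres (\<open>norm_le_loc_norm\<close>): every Euclidean bound
  or Lipschitz estimate for \<open>f\<close> and \<open>g\<close> turns into one in local norms at the price of a power
  of \<open>\<kappa>\<close>. On the other hand, \<open>\<parallel>y - c\<parallel>\<^sub>c \<le> \<eta>\<close> forces each slack at \<open>y\<close> to differ from its
  value at \<open>c\<close> by a factor in \<open>[1/2, 3/2]\<close> (\<open>nbhd_slack\<close>), so the barrier Hessian is comparable to
  the one at \<open>c\<close> and Lipschitz relative to it, however close \<open>c\<close> is to the boundary
  (\<open>barrier_hess_nbhd_bounds\<close>, \<open>barrier_hess_nbhd_lipschitz\<close>). Adding the two contributions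
  gives the bounds for \<open>\<psi>\<^sub>\<mu>\<close>, the lower one because \<open>g\<close> is convex in \<open>y\<close>.

  Dual and operator norms are bounded by duality, from estimates of the bilinear form
  \<open>(M u) \<bullet> v\<close> (\<open>dual_norm_le\<close>, \<open>opnorm_2_le\<close>, \<open>opnorm_c_le\<close>).
\<close>

section \<open>Slacks and the interior of the polytope\<close>

definition slack :: "real^'q^'m \<Rightarrow> real^'m \<Rightarrow> real^'q \<Rightarrow> 'm \<Rightarrow> real" where
  "slack A b y i = b $ i - row i A \<bullet> y"

lemma feasible_iff_slack: "y \<in> feasible A b \<longleftrightarrow> (\<forall>i. 0 \<le> slack A b y i)"
proof -
  have "(A *v y) $ i = row i A \<bullet> y" for i
    by (simp add: matrix_vector_mult_def row_def inner_vec_def)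
  then show ?thesis
    by (simp add: feasible_def slack_def less_eq_vec_def)
qed

lemma slack_diff: "slack A b y i - slack A b z i = row i A \<bullet> (z - y)"
  by (simp add: slack_def inner_diff_right)

lemma continuous_on_slack: "continuous_on S (\<lambda>y. slack A b y i)"
  unfolding slack_def by (intro continuous_intros)

text \<open>A zero row has constant slack, possibly \<open>0\<close>; it contributes a constant to the barrier
  and nothing to its derivatives. All positivity statements about slacks therefore concern
  nonzero rows.\<close>

lemma interior_slack_pos:
  assumes "y \<in> interior (feasible A b)" "row i A \<noteq> 0"
  shows "0 < slack A b y i"
proof -
  obtain e where e: "0 < e" "cball y e \<subseteq> feasible A b"
    using assms(1) unfolding mem_interior_cball by blast
  \<comment> \<open>Moving towards the constraint inside a feasible ball lowers the slack strictly.\<close>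
  define z where "z = y + (e / norm (row i A)) *\<^sub>R row i A"
  have "dist y z = e"
    using assms(2) e(1) by (simp add: z_def dist_norm)
  then have "0 \<le> slack A b z i"
    using e feasible_iff_slack[of z A b] by auto
  moreover have "slack A b y i - slack A b z i = e * norm (row i A)"
    using assms(2) unfolding slack_diff by (simp add: z_def dot_square_norm power2_eq_square)
  ultimately show ?thesis
    using e(1) assms(2) by (smt (verit) mult_pos_pos zero_less_norm_iff)
qed

lemma slack_pos_interior:
  assumes "y \<in> feasible A b" "\<And>i. row i A \<noteq> 0 \<Longrightarrow> 0 < slack A b y i"
  shows "y \<in> interior (feasible A b)"
proof (rule interiorI)
  let ?U = "\<Inter>i\<in>{i. row i A \<noteq> 0}. {z. 0 < slack A b z i}"
  show "open ?U"
    by (intro open_INT ballI open_Collect_less continuous_on_const continuous_on_slack) simp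
  show "y \<in> ?U" using assms(2) by simp
  show "?U \<subseteq> feasible A b"
  proof
    fix z assume z: "z \<in> ?U"
    have "0 \<le> slack A b z i" for i
    proof (cases "row i A = 0")
      case True
      then show ?thesis
        using assms(1) unfolding feasible_iff_slack by (auto simp: slack_def dest!: spec[of _ i])
    next
      case False
      then show ?thesis using z by force
    qed
    then show "z \<in> feasible A b" by (simp add: feasible_iff_slack)
  qed
qed


section \<open>Derivatives of the barrier and the local norm\<close>

lemma gradient_eq:
  assumes "GDERIV h z :> D"
  shows "gradient h z = D"
  unfolding gradient_def
proof (rule the_equality)
  show "GDERIV h z :> D" by (rule assms)
  fix D' assume "GDERIV h z :> D'"
  then have "(\<lambda>v. v \<bullet> D') = (\<lambda>v. v \<bullet> D)"
    using assms unfolding gderiv_def by (rule has_derivative_unique)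
  then show "D' = D" using vector_eq_rdot[of D' D] by (simp add: fun_eq_iff inner_commute)
qed

lemma GDERIV_barrier:
  assumes "y \<in> interior (feasible A b)"
  shows "GDERIV (barrier A b) y :> (\<Sum>i\<in>UNIV. (1 / slack A b y i) *\<^sub>R row i A)"
proof -
  have "((\<lambda>y. ln (b $ i - row i A \<bullet> y)) has_derivative
          (\<lambda>h. - (h \<bullet> ((1 / slack A b y i) *\<^sub>R row i A)))) (at y)" for i
  proof (cases "row i A = 0")
    case False
    then have "0 < b $ i - row i A \<bullet> y"
      using interior_slack_pos[OF assms] by (simp add: slack_def)
    then show ?thesis
      by (auto intro!: derivative_eq_intros simp: slack_def inner_commute divide_inverse)
  qed simp
  then have "((\<lambda>y. - (\<Sum>i\<in>UNIV. ln (b $ i - row i A \<bullet> y))) has_derivative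
          (\<lambda>h. - (\<Sum>i\<in>UNIV. - (h \<bullet> ((1 / slack A b y i) *\<^sub>R row i A))))) (at y)"
    by (intro has_derivative_minus has_derivative_sum)
  then show ?thesis
    by (simp add: gderiv_def barrier_def[abs_def] inner_sum_right sum_negf)
qed

lemma gradient_barrier_has_derivative:
  assumes "c \<in> interior (feasible A b)"
  shows "(gradient (barrier A b) has_derivative
           (\<lambda>u. \<Sum>i\<in>UNIV. ((row i A \<bullet> u) / (slack A b c i)\<^sup>2) *\<^sub>R row i A)) (at c)"
proof -
  have "((\<lambda>y. (1 / slack A b y i) *\<^sub>R row i A) has_derivative
          (\<lambda>u. ((row i A \<bullet> u) / (slack A b c i)\<^sup>2) *\<^sub>R row i A)) (at c)" for i
  proof (cases "row i A = 0")
    case False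
    then have "b $ i - row i A \<bullet> c \<noteq> 0"
      using interior_slack_pos[OF assms, of i] by (simp add: slack_def)
    then show ?thesis
      unfolding slack_def
      by (auto intro!: derivative_eq_intros simp: power2_eq_square)
  qed simp
  then have "((\<lambda>y. \<Sum>i\<in>UNIV. (1 / slack A b y i) *\<^sub>R row i A) has_derivative
          (\<lambda>u. \<Sum>i\<in>UNIV. ((row i A \<bullet> u) / (slack A b c i)\<^sup>2) *\<^sub>R row i A)) (at c)"
    by (intro has_derivative_sum)
  then show ?thesis
    by (rule has_derivative_transform_within_open[OF _ open_interior assms])
       (simp add: gradient_eq[OF GDERIV_barrier])
qed

lemma jacobian_mult:
  fixes h :: "real^'a \<Rightarrow> real^'b"
  assumes "(h has_derivative h') (at z)"
  shows "jacobian h (at z) *v u = h' u"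
  using assms frechet_derivative_at[OF assms] has_derivative_linear[OF assms]
  by (simp add: jacobian_def matrix_works)

lemma barrier_hess_mult:
  assumes "c \<in> interior (feasible A b)"
  shows "barrier_hess A b c *v u
           = (\<Sum>i\<in>UNIV. ((row i A \<bullet> u) / (slack A b c i)\<^sup>2) *\<^sub>R row i A)"
  unfolding barrier_hess_def
  by (rule jacobian_mult[OF gradient_barrier_has_derivative[OF assms]])

lemma barrier_hess_inner:
  assumes "c \<in> interior (feasible A b)"
  shows "(barrier_hess A b c *v u) \<bullet> v
           = (\<Sum>i\<in>UNIV. (row i A \<bullet> u) * (row i A \<bullet> v) / (slack A b c i)\<^sup>2)"
  by (simp add: barrier_hess_mult[OF assms] inner_sum_left)

text \<open>The local norm is a weighted Euclidean norm of the row products \<open>a\<^sub>i \<bullet> u\<close>; this turns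
  every estimate below into a row-by-row comparison of slacks.\<close>

lemma loc_norm_eq:
  assumes "c \<in> interior (feasible A b)"
  shows "loc_norm A b c u = L2_set (\<lambda>i. (row i A \<bullet> u) / slack A b c i) UNIV"
  by (simp add: loc_norm_def barrier_hess_inner[OF assms] L2_set_def power2_eq_square)

lemma loc_norm_nonneg:
  assumes "c \<in> interior (feasible A b)"
  shows "0 \<le> loc_norm A b c u"
  by (simp add: loc_norm_eq[OF assms] L2_set_nonneg)

lemma loc_norm_square:
  assumes "c \<in> interior (feasible A b)"
  shows "(barrier_hess A b c *v u) \<bullet> u = (loc_norm A b c u)\<^sup>2"
  unfolding loc_norm_def
  by (subst real_sqrt_pow2) (auto simp: barrier_hess_inner[OF assms] intro!: sum_nonneg)

lemma row_le_loc_norm: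
  assumes "c \<in> interior (feasible A b)"
  shows "\<bar>row i A \<bullet> u\<bar> \<le> \<bar>slack A b c i\<bar> * loc_norm A b c u"
proof (cases "row i A = 0")
  case False
  then have "0 < slack A b c i" using interior_slack_pos[OF assms] by blast
  moreover have "\<bar>(row i A \<bullet> u) / slack A b c i\<bar> \<le> loc_norm A b c u"
    unfolding loc_norm_eq[OF assms]
    using member_le_L2_set[of UNIV i "\<lambda>i. \<bar>(row i A \<bullet> u) / slack A b c i\<bar>"]
    by (simp add: L2_set_def power_divide)
  ultimately show ?thesis by (simp add: abs_div_pos[symmetric] field_simps)
qed (simp add: loc_norm_nonneg[OF assms])

text \<open>Boundedness of the polytope enters here. A direction orthogonal to all rows would be a
  line in the polytope, so \<open>A\<close> is injective; and slacks are bounded above, so the local norms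
  dominate the Euclidean norm with one constant for all centres.\<close>

lemma norm_le_loc_norm:
  fixes A :: "real^'q^'m"
  assumes "compact (feasible A b)" "interior (feasible A b) \<noteq> {}"
  shows "\<exists>\<kappa>>0. \<forall>c\<in>interior (feasible A b). \<forall>u. norm u \<le> \<kappa> * loc_norm A b c u"
proof -
  obtain y0 where y0: "y0 \<in> feasible A b"
    using assms(2) interior_subset by fastforce
  have row: "(A *v u) $ i = row i A \<bullet> u" for u i
    by (simp add: matrix_vector_mult_def row_def inner_vec_def)
  have "u = 0" if "A *v u = 0" for u
  proof (rule ccontr)
    assume "u \<noteq> 0"
    have "row i A \<bullet> u = 0" for i using that row[of u i] by simp
    then have mem: "y0 + t *\<^sub>R u \<in> feasible A b" for t
      using y0 by (simp add: feasible_iff_slack slack_def inner_add_right)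
    obtain B where B: "\<And>y. y \<in> feasible A b \<Longrightarrow> norm y \<le> B"
      using compact_imp_bounded[OF assms(1)] unfolding bounded_iff by blast
    have "norm ((y0 + ((2 * B + 1) / norm u) *\<^sub>R u) - y0) \<le> 2 * B"
      using B[OF mem[of "(2 * B + 1) / norm u"]] B[OF y0] norm_triangle_ineq4 by (smt (verit))
    then show False using \<open>u \<noteq> 0\<close> by auto
  qed
  then have "inj ((*v) A)"
    by (simp add: linear_injective_0)
  then obtain B where B: "B > 0" "\<And>u. B * norm u \<le> norm (A *v u)"
    using linear_inj_bounded_below_pos[of "(*v) A"] by (metis matrix_vector_mul_linear)
  have "\<exists>S. \<forall>y\<in>feasible A b. \<bar>slack A b y i\<bar> \<le> S" for i
    using compact_imp_bounded[OF compact_continuous_image[OF continuous_on_slack assms(1)], of A b i]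
    unfolding bounded_iff by auto
  then obtain S where S: "\<And>i y. y \<in> feasible A b \<Longrightarrow> \<bar>slack A b y i\<bar> \<le> S i" by metis
  have S0: "0 \<le> S i" for i using S[OF y0, of i] by linarith
  show ?thesis
  proof (intro exI conjI ballI allI)
    show "0 < (sum S UNIV + 1) / B" using B(1) S0 by (simp add: add_nonneg_pos sum_nonneg)
    fix c u assume c: "c \<in> interior (feasible A b)"
    then have c': "c \<in> feasible A b" using interior_subset by blast
    have "B * norm u \<le> (\<Sum>i\<in>UNIV. \<bar>row i A \<bullet> u\<bar>)"
      using B(2)[of u] norm_le_l1_cart[of "A *v u"] by (simp add: row)
    also have "\<dots> \<le> (\<Sum>i\<in>UNIV. S i * loc_norm A b c u)"
      by (intro sum_mono order_trans[OF row_le_loc_norm[OF c]] mult_right_mono S c'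
          loc_norm_nonneg c)
    also have "\<dots> \<le> (sum S UNIV + 1) * loc_norm A b c u"
      using loc_norm_nonneg[OF c, of u] by (simp add: sum_distrib_right distrib_right)
    finally show "norm u \<le> (sum S UNIV + 1) / B * loc_norm A b c u"
      using B(1) by (simp add: field_simps)
  qed
qed

corollary loc_norm_definite:
  assumes "compact (feasible A b)" "c \<in> interior (feasible A b)" "loc_norm A b c u = 0"
  shows "u = 0"
proof -
  obtain \<kappa> where "norm u \<le> \<kappa> * loc_norm A b c u"
    using norm_le_loc_norm[OF assms(1)] assms(2) by blast
  then show ?thesis using assms(3) by simp
qed


section \<open>Bounding dual and operator norms\<close>

lemma barrier_hess_dual_apply:
  fixes A :: "real^'q^'m"
  assumes "compact (feasible A b)" "c \<in> interior (feasible A b)"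
  shows "barrier_hess A b c *v (matrix_inv (barrier_hess A b c) *v w) = w"
proof -
  let ?H = "barrier_hess A b c"
  have "u = 0" if "?H *v u = 0" for u
    using loc_norm_square[OF assms(2), of u] that
    by (intro loc_norm_definite[OF assms]) simp
  then have "invertible ?H"
    by (simp add: invertible_left_inverse matrix_left_invertible_ker)
  then have "?H ** matrix_inv ?H = mat 1"
    unfolding invertible_def matrix_inv_def by (rule someI2_ex) simp
  then show ?thesis by (simp add: matrix_vector_mul_assoc)
qed

text \<open>Bounding a dual norm means bounding a pairing against the local norm, so the inverse
  Hessian never has to be computed.\<close>

lemma dual_norm_le:
  fixes A :: "real^'q^'m"
  assumes "compact (feasible A b)" and c: "c \<in> interior (feasible A b)" and "0 \<le> K"
    and pair: "\<And>v. w \<bullet> v \<le> K * loc_norm A b c v"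
  shows "dual_norm A b c w \<le> K"
proof -
  define v where "v = matrix_inv (barrier_hess A b c) *v w"
  have Hv: "barrier_hess A b c *v v = w"
    unfolding v_def by (rule barrier_hess_dual_apply[OF assms(1,2)])
  have "(loc_norm A b c v)\<^sup>2 \<le> K * loc_norm A b c v"
    using pair[of v] loc_norm_square[OF c, of v] by (simp add: Hv)
  then have "loc_norm A b c v \<le> K"
    using loc_norm_nonneg[OF c, of v] assms(3)
    by (cases "loc_norm A b c v = 0") (auto simp: power2_eq_square)
  moreover have "dual_norm A b c w = loc_norm A b c v"
    unfolding dual_norm_def loc_norm_def Hv v_def[symmetric] by (simp add: inner_commute)
  ultimately show ?thesis by simp
qed

lemma opnorm_2_le:
  fixes A :: "real^'q^'m" and M :: "real^'p^'q"
  assumes "compact (feasible A b)" "c \<in> interior (feasible A b)" "0 \<le> K"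
    and pair: "\<And>u v. (M *v u) \<bullet> v \<le> K * norm u * loc_norm A b c v"
  shows "opnorm_2 A b c M \<le> K"
  unfolding opnorm_2_def
proof (rule cSUP_least)
  show "{u :: real^'p. norm u = 1} \<noteq> {}"
    by (auto intro!: exI[of _ "axis undefined 1"] simp: norm_axis_1)
  show "dual_norm A b c (M *v u) \<le> K" if "u \<in> {u. norm u = 1}" for u
    using pair[of u] that by (intro dual_norm_le assms) auto
qed

lemma opnorm_c_le:
  fixes A :: "real^'q^'m"
  assumes "compact (feasible A b)" and c: "c \<in> interior (feasible A b)" and "0 \<le> K"
    and pair: "\<And>u v. (M *v u) \<bullet> v \<le> K * loc_norm A b c u * loc_norm A b c v"
  shows "opnorm_c A b c M \<le> K"
  unfolding opnorm_c_def
proof (rule cSUP_least)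
  define u :: "real^'q" where "u = axis undefined 1"
  have "u \<noteq> 0" unfolding u_def by (simp add: axis_eq_0_iff)
  then have "0 < loc_norm A b c u"
    using loc_norm_definite[OF assms(1) c, of u] loc_norm_nonneg[OF c, of u] by linarith
  moreover have "loc_norm A b c (r *\<^sub>R u) = r * loc_norm A b c u" if "0 \<le> r" for r
    using that by (simp add: loc_norm_eq[OF c] L2_set_right_distrib)
  ultimately have "loc_norm A b c ((1 / loc_norm A b c u) *\<^sub>R u) = 1" by simp
  then show "{u. loc_norm A b c u = 1} \<noteq> {}" by blast
  show "dual_norm A b c (M *v u) \<le> K" if "u \<in> {u. loc_norm A b c u = 1}" for u
    using pair[of u] that by (intro dual_norm_le assms) auto
qed


section \<open>The barrier Hessian on a local neighbourhood\<close>

lemma nbhd_slack: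
  assumes c: "c \<in> interior (feasible A b)" and y: "y \<in> nbhd A b \<eta> c" and "\<eta> \<le> 1 / 2"
    and "row i A \<noteq> 0"
  shows "0 < slack A b c i" "slack A b c i / 2 \<le> slack A b y i"
    "slack A b y i \<le> 3 / 2 * slack A b c i"
proof -
  show s: "0 < slack A b c i" using interior_slack_pos c assms(4) by blast
  have "loc_norm A b c (y - c) \<le> 1 / 2" using y assms(3) by (simp add: nbhd_def)
  then have "slack A b c i * loc_norm A b c (y - c) \<le> slack A b c i * (1 / 2)"
    by (rule mult_left_mono) (use s in simp)
  then have "\<bar>row i A \<bullet> (y - c)\<bar> \<le> slack A b c i / 2"
    using row_le_loc_norm[OF c, of i "y - c"] s by linarith
  moreover have "slack A b c i - slack A b y i = row i A \<bullet> (y - c)" by (rule slack_diff)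
  ultimately show "slack A b c i / 2 \<le> slack A b y i" "slack A b y i \<le> 3 / 2 * slack A b c i"
    by linarith+
qed

text \<open>On the neighbourhood every slack is within \<open>[1/2, 3/2]\<close> of its value at the centre, and
  the Hessian is quadratic in the inverse slacks; hence the factors \<open>(2/3)\<^sup>2\<close> and \<open>2\<^sup>2\<close>.\<close>

lemma barrier_hess_nbhd_bounds:
  assumes c: "c \<in> interior (feasible A b)" and y: "y \<in> nbhd A b \<eta> c" and \<eta>: "\<eta> \<le> 1 / 2"
  shows "4 / 9 * (loc_norm A b c u)\<^sup>2 \<le> (barrier_hess A b y *v u) \<bullet> u"
    and "(barrier_hess A b y *v u) \<bullet> u \<le> 4 * (loc_norm A b c u)\<^sup>2"
proof -
  have y': "y \<in> interior (feasible A b)" using y by (simp add: nbhd_def)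
  let ?s = "slack A b c" and ?t = "slack A b y"
  have lower: "4 / 9 * ((row i A \<bullet> u) * (row i A \<bullet> u) / (?s i)\<^sup>2)
      \<le> (row i A \<bullet> u) * (row i A \<bullet> u) / (?t i)\<^sup>2"
    and upper: "(row i A \<bullet> u) * (row i A \<bullet> u) / (?t i)\<^sup>2
      \<le> 4 * ((row i A \<bullet> u) * (row i A \<bullet> u) / (?s i)\<^sup>2)" for i
  proof -
    show "4 / 9 * ((row i A \<bullet> u) * (row i A \<bullet> u) / (?s i)\<^sup>2)
      \<le> (row i A \<bullet> u) * (row i A \<bullet> u) / (?t i)\<^sup>2"
    proof (cases "row i A = 0")
      case False
      note s = nbhd_slack[OF c y \<eta> False]
      have "(row i A \<bullet> u) * (row i A \<bullet> u) / (3 / 2 * ?s i)\<^sup>2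
          \<le> (row i A \<bullet> u) * (row i A \<bullet> u) / (?t i)\<^sup>2"
        using s by (intro divide_left_mono power_mono mult_pos_pos) auto
      then show ?thesis by (simp add: power2_eq_square)
    qed simp
    show "(row i A \<bullet> u) * (row i A \<bullet> u) / (?t i)\<^sup>2
      \<le> 4 * ((row i A \<bullet> u) * (row i A \<bullet> u) / (?s i)\<^sup>2)"
    proof (cases "row i A = 0")
      case False
      note s = nbhd_slack[OF c y \<eta> False]
      have "(row i A \<bullet> u) * (row i A \<bullet> u) / (?t i)\<^sup>2
          \<le> (row i A \<bullet> u) * (row i A \<bullet> u) / (?s i / 2)\<^sup>2"
        using s by (intro divide_left_mono power_mono mult_pos_pos) auto
      then show ?thesis by (simp add: power2_eq_square mult.commute)
    qed simp
  qed
  show "4 / 9 * (loc_norm A b c u)\<^sup>2 \<le> (barrier_hess A b y *v u) \<bullet> u"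
    and "(barrier_hess A b y *v u) \<bullet> u \<le> 4 * (loc_norm A b c u)\<^sup>2"
    unfolding loc_norm_square[OF c, symmetric] barrier_hess_inner[OF c] barrier_hess_inner[OF y']
      sum_distrib_left
    using lower upper by (auto intro!: sum_mono)
qed

lemma inverse_square_lipschitz:
  fixes s t1 t2 d :: real
  assumes "0 < s" "s / 2 \<le> t1" "s / 2 \<le> t2" "\<bar>t1 - t2\<bar> \<le> s * d"
  shows "\<bar>1 / t1\<^sup>2 - 1 / t2\<^sup>2\<bar> \<le> 16 * d / s\<^sup>2"
proof -
  have t: "0 < t1" "0 < t2" using assms by linarith+
  have inv: "1 / t1 \<le> 2 / s" "1 / t2 \<le> 2 / s" using assms(1-3) t by (auto simp: field_simps)
  have "1 / t1\<^sup>2 - 1 / t2\<^sup>2 = (t2 - t1) * ((1 / t1) * (1 / t2) * (1 / t1 + 1 / t2))"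
    using t by (simp add: field_simps power2_eq_square)
  then have "\<bar>1 / t1\<^sup>2 - 1 / t2\<^sup>2\<bar> = \<bar>t1 - t2\<bar> * ((1 / t1) * (1 / t2) * (1 / t1 + 1 / t2))"
    using t by (simp add: abs_mult abs_minus_commute)
  also have "\<dots> \<le> (s * d) * ((2 / s) * (2 / s) * (2 / s + 2 / s))"
    using assms(1,4) t inv
    by (intro mult_mono add_mono) (auto intro: order_trans[OF abs_ge_zero])
  also have "\<dots> = 16 * d / s\<^sup>2"
    using assms(1) by (simp add: field_simps power2_eq_square)
  finally show ?thesis .
qed

text \<open>Each inverse squared slack is Lipschitz along the neighbourhood with a constant relative
  to its own value at the centre; the Cauchy-Schwarz inequality over the rows then assembles
  the local norms of both arguments.\<close>

lemma barrier_hess_nbhd_lipschitz: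
  assumes c: "c \<in> interior (feasible A b)" and \<eta>: "\<eta> \<le> 1 / 2"
    and y1: "y1 \<in> nbhd A b \<eta> c" and y2: "y2 \<in> nbhd A b \<eta> c"
  shows "((barrier_hess A b y1 - barrier_hess A b y2) *v u) \<bullet> v
           \<le> 16 * loc_norm A b c (y1 - y2) * loc_norm A b c u * loc_norm A b c v"
proof -
  let ?s = "slack A b c" and ?N = "loc_norm A b c"
  have int: "y1 \<in> interior (feasible A b)" "y2 \<in> interior (feasible A b)"
    using y1 y2 by (auto simp: nbhd_def)
  have row: "(row i A \<bullet> u) * (row i A \<bullet> v) / (slack A b y1 i)\<^sup>2
        - (row i A \<bullet> u) * (row i A \<bullet> v) / (slack A b y2 i)\<^sup>2
      \<le> 16 * ?N (y1 - y2) * (\<bar>(row i A \<bullet> u) / ?s i\<bar> * \<bar>(row i A \<bullet> v) / ?s i\<bar>)" for i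
  proof (cases "row i A = 0")
    case False
    note s1 = nbhd_slack[OF c y1 \<eta> False] and s2 = nbhd_slack[OF c y2 \<eta> False]
    have "\<bar>slack A b y1 i - slack A b y2 i\<bar> \<le> ?s i * ?N (y1 - y2)"
      using row_le_loc_norm[OF c, of i "y1 - y2"] s1(1)
      by (simp add: slack_diff inner_diff_right abs_minus_commute)
    then have "\<bar>1 / (slack A b y1 i)\<^sup>2 - 1 / (slack A b y2 i)\<^sup>2\<bar> \<le> 16 * ?N (y1 - y2) / (?s i)\<^sup>2"
      by (intro inverse_square_lipschitz s1 s2)
    then have "\<bar>(row i A \<bullet> u) * (row i A \<bullet> v)\<bar>
          * \<bar>1 / (slack A b y1 i)\<^sup>2 - 1 / (slack A b y2 i)\<^sup>2\<bar>
        \<le> \<bar>(row i A \<bullet> u) * (row i A \<bullet> v)\<bar> * (16 * ?N (y1 - y2) / (?s i)\<^sup>2)"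
      by (intro mult_left_mono) auto
    then show ?thesis
      unfolding abs_mult[symmetric]
      by (simp add: abs_mult abs_divide power2_eq_square right_diff_distrib ac_simps)
  qed simp
  have "((barrier_hess A b y1 - barrier_hess A b y2) *v u) \<bullet> v
      = (\<Sum>i\<in>UNIV. (row i A \<bullet> u) * (row i A \<bullet> v) / (slack A b y1 i)\<^sup>2
          - (row i A \<bullet> u) * (row i A \<bullet> v) / (slack A b y2 i)\<^sup>2)"
    by (simp add: matrix_vector_mult_diff_rdistrib inner_diff_left int barrier_hess_inner
        sum_subtractf)
  also have "\<dots> \<le> 16 * ?N (y1 - y2) * (\<Sum>i\<in>UNIV. \<bar>(row i A \<bullet> u) / ?s i\<bar> * \<bar>(row i A \<bullet> v) / ?s i\<bar>)"
    unfolding sum_distrib_left by (intro sum_mono row)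
  also have "\<dots> \<le> 16 * ?N (y1 - y2) * (?N u * ?N v)"
    unfolding loc_norm_eq[OF c, of u] loc_norm_eq[OF c, of v]
    by (intro mult_left_mono L2_set_mult_ineq) (simp add: loc_norm_nonneg[OF c])
  finally show ?thesis by (simp add: mult.assoc)
qed


section \<open>Hessian blocks of smooth functions on a product\<close>

lemma GDERIV_gradient:
  fixes h :: "'a::euclidean_space \<Rightarrow> real"
  assumes "h differentiable (at z)"
  shows "GDERIV h z :> gradient h z"
proof -
  obtain h' where h': "(h has_derivative h') (at z)"
    using assms by (auto simp: differentiable_def)
  then have "linear h'" by (rule has_derivative_linear)
  then have "v \<bullet> adjoint h' 1 = h' v" for v
    using adjoint_works[of h' v 1] by simp
  then have "GDERIV h z :> adjoint h' 1" using h' by (simp add: gderiv_def)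
  then show ?thesis using gradient_eq by metis
qed

lemma hessian_has_derivative:
  fixes h :: "'a::euclidean_space \<Rightarrow> real"
  assumes "gradient h differentiable (at z)"
  shows "(gradient h has_derivative blinfun_apply (hessian h z)) (at z)"
proof -
  have "(gradient h has_derivative frechet_derivative (gradient h) (at z)) (at z)"
    using assms by (simp add: frechet_derivative_works)
  then show ?thesis
    by (simp add: hessian_def bounded_linear_Blinfun_apply has_derivative_bounded_linear)
qed

lemma DERIV_abs_le:
  fixes \<phi> :: "real \<Rightarrow> real"
  assumes "DERIV \<phi> 0 :> d" "\<And>t. \<bar>\<phi> t - \<phi> 0\<bar> \<le> K * \<bar>t\<bar>"
  shows "\<bar>d\<bar> \<le> K"
proof -
  have "((\<lambda>t. \<bar>(\<phi> (0 + t) - \<phi> 0) / t\<bar>) \<longlongrightarrow> \<bar>d\<bar>) (at 0)"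
    using assms(1) unfolding DERIV_def by (rule tendsto_rabs)
  moreover have "\<forall>\<^sub>F t in at 0. \<bar>(\<phi> (0 + t) - \<phi> 0) / t\<bar> \<le> K"
    using assms(2) by (auto simp: eventually_at_filter abs_divide divide_le_eq)
  ultimately show ?thesis by (rule tendsto_upperbound) simp
qed

lemma DERIV_nonneg_of_mono:
  fixes \<phi> :: "real \<Rightarrow> real"
  assumes "DERIV \<phi> 0 :> d" "\<And>t. 0 \<le> t * (\<phi> t - \<phi> 0)"
  shows "0 \<le> d"
proof -
  have "((\<lambda>t. (\<phi> (0 + t) - \<phi> 0) / t) \<longlongrightarrow> d) (at 0)"
    using assms(1) unfolding DERIV_def .
  moreover have "\<forall>\<^sub>F t in at 0. 0 \<le> (\<phi> (0 + t) - \<phi> 0) / t"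
  proof (intro always_eventually allI)
    fix t show "0 \<le> (\<phi> (0 + t) - \<phi> 0) / t"
      using assms(2)[of t] by (auto simp: zero_le_divide_iff zero_le_mult_iff)
  qed
  ultimately show ?thesis by (rule tendsto_lowerbound) simp
qed

lemma DERIV_gradient_line:
  fixes h :: "'a::euclidean_space \<Rightarrow> real"
  assumes "gradient h differentiable (at z)"
  shows "DERIV (\<lambda>t. gradient h (z + t *\<^sub>R v) \<bullet> w) 0 :> blinfun_apply (hessian h z) v \<bullet> w"
proof -
  have "((\<lambda>t. z + t *\<^sub>R v) has_derivative (\<lambda>t. t *\<^sub>R v)) (at (0::real))"
    by (auto intro!: derivative_eq_intros)
  then have "((\<lambda>t. gradient h (z + t *\<^sub>R v)) has_derivative
      (\<lambda>t. blinfun_apply (hessian h z) (t *\<^sub>R v))) (at (0::real))"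
    by (rule has_derivative_compose) (simp add: hessian_has_derivative[OF assms])
  then have "((\<lambda>t. gradient h (z + t *\<^sub>R v) \<bullet> w) has_derivative
      (\<lambda>t. blinfun_apply (hessian h z) (t *\<^sub>R v) \<bullet> w)) (at (0::real))"
    by (rule has_derivative_inner_left)
  then show ?thesis
    by (simp add: has_field_derivative_def blinfun.scaleR_right mult_commute_abs)
qed

text \<open>The Lipschitz constant of the gradient bounds the difference quotients along a line, and
  hence their limit.\<close>

lemma hessian_pairing_le:
  fixes h :: "'a::euclidean_space \<Rightarrow> real"
  assumes "gradient h differentiable (at z)" and lip: "l-lipschitz_on UNIV (gradient h)"
  shows "\<bar>blinfun_apply (hessian h z) v \<bullet> w\<bar> \<le> l * norm v * norm w"
proof (rule DERIV_abs_le[OF DERIV_gradient_line[OF assms(1)]])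
  fix t :: real
  have "norm (gradient h (z + t *\<^sub>R v) - gradient h z) \<le> l * norm (t *\<^sub>R v)"
    using lipschitz_onD[OF lip, of "z + t *\<^sub>R v" z] by (simp add: dist_norm)
  then have "norm (gradient h (z + t *\<^sub>R v) - gradient h z) * norm w \<le> l * norm (t *\<^sub>R v) * norm w"
    by (rule mult_right_mono) simp
  then show "\<bar>gradient h (z + t *\<^sub>R v) \<bullet> w - gradient h (z + 0 *\<^sub>R v) \<bullet> w\<bar>
      \<le> l * norm v * norm w * \<bar>t\<bar>"
    using Cauchy_Schwarz_ineq2[of "gradient h (z + t *\<^sub>R v) - gradient h z" w]
    by (simp add: inner_diff_left ac_simps)
qed

lemma GDERIV_section:
  fixes h :: "(real^'p) \<times> (real^'q) \<Rightarrow> real"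
  assumes "\<And>z. h differentiable (at z)"
  shows "GDERIV (\<lambda>y. h (x, y)) y :> snd (gradient h (x, y))"
proof -
  have "((\<lambda>y. (x, y)) has_derivative (\<lambda>u. (0, u))) (at y)"
    by (auto intro!: derivative_eq_intros)
  then have "((\<lambda>y. h (x, y)) has_derivative (\<lambda>u. (0, u) \<bullet> gradient h (x, y))) (at y)"
    by (rule has_derivative_compose)
       (use GDERIV_gradient[OF assms, of "(x, y)"] in \<open>simp add: gderiv_def\<close>)
  then show ?thesis by (simp add: gderiv_def inner_prod_def)
qed

lemma grad_y_eq:
  fixes h :: "(real^'p) \<times> (real^'q) \<Rightarrow> real"
  assumes "\<And>z. h differentiable (at z)"
  shows "grad_y h x y = snd (gradient h (x, y))"
  unfolding grad_y_def by (rule gradient_eq[OF GDERIV_section[OF assms]])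

lemma grad_y_has_derivative_y:
  assumes "twice_continuously_differentiable h"
  shows "((\<lambda>y. grad_y h x y) has_derivative
           (\<lambda>u. snd (blinfun_apply (hessian h (x, y)) (0, u)))) (at y)"
proof -
  have h: "\<And>z. h differentiable (at z)" "\<And>z. gradient h differentiable (at z)"
    using assms by (auto simp: twice_continuously_differentiable_def)
  have "((\<lambda>y. (x, y)) has_derivative (\<lambda>u. (0, u))) (at y)"
    by (auto intro!: derivative_eq_intros)
  then have "((\<lambda>y. gradient h (x, y)) has_derivative
      (\<lambda>u. blinfun_apply (hessian h (x, y)) (0, u))) (at y)"
    by (rule has_derivative_compose[OF _ hessian_has_derivative[OF h(2)]])
  then show ?thesis
    unfolding grad_y_eq[OF h(1)] by (rule has_derivative_snd)
qed

lemma grad_y_has_derivative_x: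
  assumes "twice_continuously_differentiable h"
  shows "((\<lambda>x. grad_y h x y) has_derivative
           (\<lambda>u. snd (blinfun_apply (hessian h (x, y)) (u, 0)))) (at x)"
proof -
  have h: "\<And>z. h differentiable (at z)" "\<And>z. gradient h differentiable (at z)"
    using assms by (auto simp: twice_continuously_differentiable_def)
  have "((\<lambda>x. (x, y)) has_derivative (\<lambda>u. (u, 0))) (at x)"
    by (auto intro!: derivative_eq_intros)
  then have "((\<lambda>x. gradient h (x, y)) has_derivative
      (\<lambda>u. blinfun_apply (hessian h (x, y)) (u, 0))) (at x)"
    by (rule has_derivative_compose[OF _ hessian_has_derivative[OF h(2)]])
  then show ?thesis
    unfolding grad_y_eq[OF h(1)] by (rule has_derivative_snd)
qed

lemma hess_yy_mult:
  assumes "twice_continuously_differentiable h"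
  shows "hess_yy h x y *v u = snd (blinfun_apply (hessian h (x, y)) (0, u))"
  unfolding hess_yy_def by (rule jacobian_mult[OF grad_y_has_derivative_y[OF assms]])

lemma hess_xy_mult:
  assumes "twice_continuously_differentiable h"
  shows "hess_xy h x y *v u = snd (blinfun_apply (hessian h (x, y)) (u, 0))"
  unfolding hess_xy_def by (rule jacobian_mult[OF grad_y_has_derivative_x[OF assms]])

lemma snd_inner: "snd p \<bullet> v = p \<bullet> (0, v)"
  by (simp add: inner_prod_def)

lemma hess_blocks_pairing_le:
  fixes h :: "(real^'p) \<times> (real^'q) \<Rightarrow> real"
  assumes h: "twice_continuously_differentiable h" and lip: "l-lipschitz_on UNIV (gradient h)"
  shows "(hess_yy h x y *v u) \<bullet> v \<le> l * norm u * norm v"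
    and "(hess_xy h x y *v w) \<bullet> v \<le> l * norm w * norm v"
proof -
  have d: "gradient h differentiable (at (x, y))"
    using h by (auto simp: twice_continuously_differentiable_def)
  show "(hess_yy h x y *v u) \<bullet> v \<le> l * norm u * norm v"
    using hessian_pairing_le[OF d lip, of "(0, u)" "(0, v)"]
    by (simp add: hess_yy_mult[OF h] snd_inner norm_Pair)
  show "(hess_xy h x y *v w) \<bullet> v \<le> l * norm w * norm v"
    using hessian_pairing_le[OF d lip, of "(w, 0)" "(0, v)"]
    by (simp add: hess_xy_mult[OF h] snd_inner norm_Pair)
qed

lemma hess_blocks_diff_pairing_le:
  fixes h :: "(real^'p) \<times> (real^'q) \<Rightarrow> real"
  assumes h: "twice_continuously_differentiable h" and lip: "l-lipschitz_on UNIV (hessian h)"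
  shows "((hess_yy h x y1 - hess_yy h x y2) *v u) \<bullet> v \<le> l * norm (y1 - y2) * norm u * norm v"
    and "((hess_xy h x y1 - hess_xy h x y2) *v w) \<bullet> v \<le> l * norm (y1 - y2) * norm w * norm v"
proof -
  have D: "norm (hessian h (x, y1) - hessian h (x, y2)) \<le> l * norm (y1 - y2)"
    using lipschitz_onD[OF lip, of "(x, y1)" "(x, y2)"] by (simp add: dist_norm norm_Pair)
  have *: "blinfun_apply (hessian h (x, y1) - hessian h (x, y2)) p \<bullet> (0, v)
      \<le> l * norm (y1 - y2) * norm p * norm v" for p
  proof -
    have "blinfun_apply (hessian h (x, y1) - hessian h (x, y2)) p \<bullet> (0, v)
        \<le> norm (blinfun_apply (hessian h (x, y1) - hessian h (x, y2)) p) * norm v"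
      using norm_cauchy_schwarz[of _ "(0, v)"] by (simp add: norm_Pair)
    also have "\<dots> \<le> (norm (hessian h (x, y1) - hessian h (x, y2)) * norm p) * norm v"
      by (intro mult_right_mono norm_blinfun) simp
    also have "\<dots> \<le> (l * norm (y1 - y2) * norm p) * norm v"
      by (intro mult_right_mono D) simp_all
    finally show ?thesis .
  qed
  show "((hess_yy h x y1 - hess_yy h x y2) *v u) \<bullet> v \<le> l * norm (y1 - y2) * norm u * norm v"
    using *[of "(0, u)"]
    by (simp add: matrix_vector_mult_diff_rdistrib hess_yy_mult[OF h] snd_inner norm_Pair
        inner_diff_left blinfun.diff_left)
  show "((hess_xy h x y1 - hess_xy h x y2) *v w) \<bullet> v \<le> l * norm (y1 - y2) * norm w * norm v"
    using *[of "(w, 0)"]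
    by (simp add: matrix_vector_mult_diff_rdistrib hess_xy_mult[OF h] snd_inner norm_Pair
        inner_diff_left blinfun.diff_left)
qed

text \<open>Along a line the convex function lies above its tangents; comparing the tangents at two
  points shows that the directional derivative is nondecreasing.\<close>

lemma hess_yy_nonneg:
  fixes h :: "(real^'p) \<times> (real^'q) \<Rightarrow> real"
  assumes h: "twice_continuously_differentiable h" and conv: "convex_on UNIV (\<lambda>y. h (x, y))"
  shows "0 \<le> (hess_yy h x y *v u) \<bullet> u"
proof -
  have d: "\<And>z. h differentiable (at z)" "\<And>z. gradient h differentiable (at z)"
    using h by (auto simp: twice_continuously_differentiable_def)
  let ?\<theta> = "\<lambda>t::real. h (x, y + t *\<^sub>R u)"
  let ?\<phi> = "\<lambda>t::real. gradient h ((x, y) + t *\<^sub>R (0, u)) \<bullet> (0, u)"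
  have \<theta>: "DERIV ?\<theta> t :> ?\<phi> t" for t
  proof -
    have "((\<lambda>t. y + t *\<^sub>R u) has_derivative (\<lambda>s. s *\<^sub>R u)) (at t)"
      by (auto intro!: derivative_eq_intros)
    then have "(?\<theta> has_derivative (\<lambda>s. (s *\<^sub>R u) \<bullet> snd (gradient h (x, y + t *\<^sub>R u)))) (at t)"
      by (rule has_derivative_compose)
         (use GDERIV_section[OF d(1), of x "y + t *\<^sub>R u"] in \<open>simp add: gderiv_def\<close>)
    then show ?thesis
      by (simp add: has_field_derivative_def inner_prod_def inner_commute mult_commute_abs)
  qed
  have convex: "convex_on UNIV ?\<theta>"
  proof (rule convex_onI)
    fix t r s :: real assume "0 < t" "t < 1"
    then have "h (x, (1 - t) *\<^sub>R (y + r *\<^sub>R u) + t *\<^sub>R (y + s *\<^sub>R u))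
        \<le> (1 - t) * ?\<theta> r + t * ?\<theta> s"
      using convex_onD[OF conv, of t "y + r *\<^sub>R u" "y + s *\<^sub>R u"] by simp
    then show "?\<theta> ((1 - t) *\<^sub>R r + t *\<^sub>R s) \<le> (1 - t) * ?\<theta> r + t * ?\<theta> s"
      by (simp add: algebra_simps)
  qed simp
  have tangent: "?\<phi> s * (t - s) \<le> ?\<theta> t - ?\<theta> s" for s t
    by (rule convex_on_imp_above_tangent[OF convex]) (use \<theta>[of s] in auto)
  have "0 \<le> t * (?\<phi> t - ?\<phi> 0)" for t
    using tangent[of 0 t] tangent[of t 0] by (simp add: algebra_simps)
  from DERIV_nonneg_of_mono[OF DERIV_gradient_line[OF d(2)] this]
  show ?thesis by (simp add: hess_yy_mult[OF h] snd_inner)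
qed

lemma strongly_convex_imp_convex_on:
  assumes "strongly_convex \<rho> h" "0 \<le> \<rho>"
  shows "convex_on UNIV h"
proof (rule convex_onI)
  fix t :: real and u v :: 'a assume t: "0 < t" "t < 1"
  then have "0 \<le> \<rho> / 2 * t * (1 - t) * (norm (u - v))\<^sup>2" using assms(2) by simp
  moreover have "h ((1 - t) *\<^sub>R u + t *\<^sub>R v)
      \<le> (1 - t) * h u + t * h v - \<rho> / 2 * t * (1 - t) * (norm (u - v))\<^sup>2"
    using assms(1) t unfolding strongly_convex_def by (meson atLeastAtMost_iff less_imp_le)
  ultimately show "h ((1 - t) *\<^sub>R u + t *\<^sub>R v) \<le> (1 - t) * h u + t * h v" by linarith
qed simp


section \<open>Derivatives of the barrier objective\<close>

lemma grad_y_psi: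
  assumes "\<And>z. g differentiable (at z)" "y \<in> interior (feasible A b)"
  shows "grad_y (psi A b g \<mu>) x y = grad_y g x y + \<mu> *\<^sub>R gradient (barrier A b) y"
proof -
  have "((\<lambda>y. g (x, y) + \<mu> * barrier A b y) has_derivative
      (\<lambda>u. u \<bullet> grad_y g x y + \<mu> * (u \<bullet> gradient (barrier A b) y))) (at y)"
    using GDERIV_section[OF assms(1), of x y] GDERIV_barrier[OF assms(2)]
    unfolding gderiv_def grad_y_eq[OF assms(1)] gradient_eq[OF GDERIV_barrier[OF assms(2)]]
    by (intro has_derivative_add has_derivative_mult_right)
  then have "GDERIV (\<lambda>y. psi A b g \<mu> (x, y)) y :> grad_y g x y + \<mu> *\<^sub>R gradient (barrier A b) y"
    by (simp add: gderiv_def psi_def inner_add_right)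
  then show ?thesis unfolding grad_y_def[of "psi A b g \<mu>"] by (rule gradient_eq)
qed

text \<open>The gradient formula is available on the interior only; since the interior is open, it
  can still be differentiated there.\<close>

lemma hess_yy_psi_mult:
  assumes g: "twice_continuously_differentiable g" and y: "y \<in> interior (feasible A b)"
  shows "hess_yy (psi A b g \<mu>) x y *v u = hess_yy g x y *v u + \<mu> *\<^sub>R (barrier_hess A b y *v u)"
proof -
  have d: "\<And>z. g differentiable (at z)"
    using g by (auto simp: twice_continuously_differentiable_def)
  have "((\<lambda>y. grad_y g x y + \<mu> *\<^sub>R gradient (barrier A b) y) has_derivative
      (\<lambda>u. hess_yy g x y *v u + \<mu> *\<^sub>R (barrier_hess A b y *v u))) (at y)"
    unfolding hess_yy_mult[OF g] barrier_hess_mult[OF y]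
    by (intro has_derivative_add has_derivative_scaleR_right grad_y_has_derivative_y[OF g]
        gradient_barrier_has_derivative[OF y])
  then have "((\<lambda>y. grad_y (psi A b g \<mu>) x y) has_derivative
      (\<lambda>u. hess_yy g x y *v u + \<mu> *\<^sub>R (barrier_hess A b y *v u))) (at y)"
    by (rule has_derivative_transform_within_open[OF _ open_interior y])
       (simp add: grad_y_psi[OF d])
  then show ?thesis unfolding hess_yy_def[of "psi A b g \<mu>"] by (rule jacobian_mult)
qed

lemma hess_xy_psi:
  assumes g: "twice_continuously_differentiable g" and y: "y \<in> interior (feasible A b)"
  shows "hess_xy (psi A b g \<mu>) x y = hess_xy g x y"
proof -
  have d: "\<And>z. g differentiable (at z)"
    using g by (auto simp: twice_continuously_differentiable_def)
  have "((\<lambda>x. grad_y g x y + \<mu> *\<^sub>R gradient (barrier A b) y) has_derivative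
      (\<lambda>u. hess_xy g x y *v u)) (at x)"
    unfolding hess_xy_mult[OF g]
    by (rule has_derivative_add_const grad_y_has_derivative_x[OF g])+
  then have "hess_xy (psi A b g \<mu>) x y *v u = hess_xy g x y *v u" for u
    unfolding hess_xy_def[of "psi A b g \<mu>"] grad_y_psi[OF d y] by (rule jacobian_mult)
  then show ?thesis by (simp add: matrix_eq)
qed


section \<open>Regularity in the local norm of a centre\<close>

locale barrier_centre =
  fixes A :: "real^'q^'m" and b :: "real^'m" and c :: "real^'q" and \<kappa> :: real
  assumes compact: "compact (feasible A b)"
    and centre: "c \<in> interior (feasible A b)"
    and \<kappa>_pos: "0 < \<kappa>"
    and norm_le: "\<And>u. norm u \<le> \<kappa> * loc_norm A b c u"
begin

abbreviation N :: "real^'q \<Rightarrow> real" where "N \<equiv> loc_norm A b c"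

lemma N_nonneg: "0 \<le> N u"
  by (rule loc_norm_nonneg[OF centre])

lemma hess_blocks_local:
  fixes h :: "(real^'p) \<times> (real^'q) \<Rightarrow> real"
  assumes h: "twice_continuously_differentiable h" and lip: "l-lipschitz_on UNIV (gradient h)"
  shows "(hess_yy h x y *v u) \<bullet> v \<le> l * \<kappa>\<^sup>2 * N u * N v"
    and "(hess_xy h x y *v w) \<bullet> v \<le> l * \<kappa> * norm w * N v"
proof -
  have l: "0 \<le> l" by (rule lipschitz_on_nonneg[OF lip])
  have "l * norm u * norm v \<le> l * (\<kappa> * N u) * (\<kappa> * N v)"
    using l \<kappa>_pos by (intro mult_mono norm_le order_refl) (simp_all add: N_nonneg)
  then show "(hess_yy h x y *v u) \<bullet> v \<le> l * \<kappa>\<^sup>2 * N u * N v"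
    using hess_blocks_pairing_le(1)[OF h lip, of x y u v] by (simp add: power2_eq_square ac_simps)
  have "l * norm w * norm v \<le> l * norm w * (\<kappa> * N v)"
    using l by (intro mult_left_mono norm_le) simp
  then show "(hess_xy h x y *v w) \<bullet> v \<le> l * \<kappa> * norm w * N v"
    using hess_blocks_pairing_le(2)[OF h lip, of x y w v] by (simp add: ac_simps)
qed

lemma hess_blocks_diff_local:
  fixes h :: "(real^'p) \<times> (real^'q) \<Rightarrow> real"
  assumes h: "twice_continuously_differentiable h" and lip: "l-lipschitz_on UNIV (hessian h)"
  shows "((hess_yy h x y1 - hess_yy h x y2) *v u) \<bullet> v \<le> l * \<kappa>^3 * N (y1 - y2) * N u * N v"
    and "((hess_xy h x y1 - hess_xy h x y2) *v w) \<bullet> v \<le> l * \<kappa>\<^sup>2 * N (y1 - y2) * norm w * N v"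
proof -
  have l: "0 \<le> l" by (rule lipschitz_on_nonneg[OF lip])
  have "l * norm (y1 - y2) * norm u * norm v \<le> l * (\<kappa> * N (y1 - y2)) * (\<kappa> * N u) * (\<kappa> * N v)"
    using l \<kappa>_pos by (intro mult_mono norm_le order_refl) (simp_all add: N_nonneg)
  then show "((hess_yy h x y1 - hess_yy h x y2) *v u) \<bullet> v \<le> l * \<kappa>^3 * N (y1 - y2) * N u * N v"
    using hess_blocks_diff_pairing_le(1)[OF h lip, of x y1 y2 u v]
    by (simp add: power3_eq_cube ac_simps)
  have "l * norm (y1 - y2) * norm w * norm v \<le> l * (\<kappa> * N (y1 - y2)) * norm w * (\<kappa> * N v)"
    using l \<kappa>_pos by (intro mult_mono norm_le order_refl) (simp_all add: N_nonneg)
  then show "((hess_xy h x y1 - hess_xy h x y2) *v w) \<bullet> v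
      \<le> l * \<kappa>\<^sup>2 * N (y1 - y2) * norm w * N v"
    using hess_blocks_diff_pairing_le(2)[OF h lip, of x y1 y2 w v]
    by (simp add: power2_eq_square ac_simps)
qed

lemma opnorm_hess_blocks_le:
  fixes h :: "(real^'p) \<times> (real^'q) \<Rightarrow> real"
  assumes h: "twice_continuously_differentiable h" and lip: "l-lipschitz_on UNIV (gradient h)"
  shows "opnorm_c A b c (hess_yy h x y) \<le> l * \<kappa>\<^sup>2"
    and "opnorm_2 A b c (hess_xy h x y) \<le> l * \<kappa>"
  using lipschitz_on_nonneg[OF lip] \<kappa>_pos
  by (auto intro!: opnorm_c_le opnorm_2_le compact centre hess_blocks_local[OF h lip])

lemma opnorm_hess_blocks_lipschitz:
  fixes h :: "(real^'p) \<times> (real^'q) \<Rightarrow> real"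
  assumes h: "twice_continuously_differentiable h" and lip: "l-lipschitz_on UNIV (hessian h)"
  shows "opnorm_c A b c (hess_yy h x y1 - hess_yy h x y2) \<le> l * \<kappa>^3 * N (y1 - y2)"
    and "opnorm_2 A b c (hess_xy h x y1 - hess_xy h x y2) \<le> l * \<kappa>\<^sup>2 * N (y1 - y2)"
  using lipschitz_on_nonneg[OF lip] \<kappa>_pos
  by (auto intro!: opnorm_c_le opnorm_2_le compact centre hess_blocks_diff_local[OF h lip]
      simp: N_nonneg)

lemma dual_norm_le_norm: "dual_norm A b c w \<le> norm w * \<kappa>"
proof (rule dual_norm_le[OF compact centre])
  show "0 \<le> norm w * \<kappa>" using \<kappa>_pos by simp
  show "w \<bullet> v \<le> norm w * \<kappa> * N v" for v
    using norm_cauchy_schwarz[of w v] mult_left_mono[OF norm_le[of v] norm_ge_zero[of w]]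
    by (simp add: mult.assoc)
qed

text \<open>The barrier alone supplies the lower bound, since the Hessian of a convex function only
  adds to it. For the upper bound the Euclidean estimate for \<open>g\<close> is converted with \<open>\<kappa>\<close>.\<close>

lemma psi_hess_yy_bounds:
  fixes g :: "(real^'p) \<times> (real^'q) \<Rightarrow> real"
  assumes g: "twice_continuously_differentiable g" and lip: "l-lipschitz_on UNIV (gradient g)"
    and conv: "convex_on UNIV (\<lambda>y. g (x, y))" and \<mu>: "0 < \<mu>" and \<eta>: "\<eta> \<le> 1 / 2"
    and y: "y \<in> nbhd A b \<eta> c"
  shows "(4 / 9 * \<mu>) *\<^sub>R barrier_hess A b c \<preceq>\<^sub>L hess_yy (psi A b g \<mu>) x y"
    and "l * \<kappa>\<^sup>2 + 4 * \<mu> \<le> K \<Longrightarrow> hess_yy (psi A b g \<mu>) x y \<preceq>\<^sub>L K *\<^sub>R barrier_hess A b c"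
proof -
  have int: "y \<in> interior (feasible A b)" using y by (simp add: nbhd_def)
  have psi: "(hess_yy (psi A b g \<mu>) x y *v u) \<bullet> u
      = (hess_yy g x y *v u) \<bullet> u + \<mu> * ((barrier_hess A b y *v u) \<bullet> u)" for u
    by (simp add: hess_yy_psi_mult[OF g int] inner_add_left)
  note H = barrier_hess_nbhd_bounds[OF centre y \<eta>]
  have "\<mu> * (4 / 9 * (N u)\<^sup>2) \<le> (hess_yy (psi A b g \<mu>) x y *v u) \<bullet> u" for u
    using psi[of u] hess_yy_nonneg[OF g conv, of y u] mult_left_mono[OF H(1)[of u], of \<mu>] \<mu>
    by linarith
  then show "(4 / 9 * \<mu>) *\<^sub>R barrier_hess A b c \<preceq>\<^sub>L hess_yy (psi A b g \<mu>) x y"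
    by (simp add: loewner_le_def matrix_vector_mult_diff_rdistrib inner_diff_left
        scaleR_matrix_vector_assoc[symmetric] loc_norm_square[OF centre] ac_simps)
  assume K: "l * \<kappa>\<^sup>2 + 4 * \<mu> \<le> K"
  have "(hess_yy (psi A b g \<mu>) x y *v u) \<bullet> u \<le> K * (N u)\<^sup>2" for u
  proof -
    have "(hess_yy (psi A b g \<mu>) x y *v u) \<bullet> u \<le> l * \<kappa>\<^sup>2 * (N u)\<^sup>2 + \<mu> * (4 * (N u)\<^sup>2)"
      unfolding psi using \<mu> H(2) hess_blocks_local(1)[OF g lip, of x y u u]
      by (intro add_mono mult_left_mono) (simp_all add: power2_eq_square mult.assoc)
    also have "\<dots> = (l * \<kappa>\<^sup>2 + 4 * \<mu>) * (N u)\<^sup>2" by (simp add: algebra_simps)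
    also have "\<dots> \<le> K * (N u)\<^sup>2" using K by (rule mult_right_mono) simp
    finally show ?thesis .
  qed
  then show "hess_yy (psi A b g \<mu>) x y \<preceq>\<^sub>L K *\<^sub>R barrier_hess A b c"
    by (simp add: loewner_le_def matrix_vector_mult_diff_rdistrib inner_diff_left
        scaleR_matrix_vector_assoc[symmetric] loc_norm_square[OF centre])
qed

lemma psi_hess_yy_lipschitz:
  fixes g :: "(real^'p) \<times> (real^'q) \<Rightarrow> real"
  assumes g: "twice_continuously_differentiable g" and lip: "l-lipschitz_on UNIV (hessian g)"
    and \<mu>: "0 < \<mu>" and \<eta>: "\<eta> \<le> 1 / 2"
    and y1: "y1 \<in> nbhd A b \<eta> c" and y2: "y2 \<in> nbhd A b \<eta> c"
  shows "opnorm_c A b c (hess_yy (psi A b g \<mu>) x y1 - hess_yy (psi A b g \<mu>) x y2)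
           \<le> (l * \<kappa>^3 + 16 * \<mu>) * N (y1 - y2)"
proof (rule opnorm_c_le[OF compact centre])
  show "0 \<le> (l * \<kappa>^3 + 16 * \<mu>) * N (y1 - y2)"
    using \<mu> \<kappa>_pos lipschitz_on_nonneg[OF lip] by (simp add: N_nonneg)
  fix u v
  have int: "y1 \<in> interior (feasible A b)" "y2 \<in> interior (feasible A b)"
    using y1 y2 by (auto simp: nbhd_def)
  have "((hess_yy (psi A b g \<mu>) x y1 - hess_yy (psi A b g \<mu>) x y2) *v u) \<bullet> v
      = ((hess_yy g x y1 - hess_yy g x y2) *v u) \<bullet> v
        + \<mu> * (((barrier_hess A b y1 - barrier_hess A b y2) *v u) \<bullet> v)"
    by (simp add: matrix_vector_mult_diff_rdistrib hess_yy_psi_mult[OF g] int inner_diff_left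
        inner_add_left right_diff_distrib)
  also have "\<dots> \<le> l * \<kappa>^3 * N (y1 - y2) * N u * N v + \<mu> * (16 * N (y1 - y2) * N u * N v)"
    using \<mu>
    by (intro add_mono mult_left_mono hess_blocks_diff_local[OF g lip]
        barrier_hess_nbhd_lipschitz[OF centre \<eta> y1 y2]) simp
  finally show "((hess_yy (psi A b g \<mu>) x y1 - hess_yy (psi A b g \<mu>) x y2) *v u) \<bullet> v
      \<le> (l * \<kappa>^3 + 16 * \<mu>) * N (y1 - y2) * N u * N v"
    by (simp add: algebra_simps)
qed

end


section \<open>Existence of barrier minimizers\<close>

text \<open>The barrier blows up at the boundary: below a suitable slack level \<open>\<delta>\<close> the objective
  exceeds its value at a reference point, and above that level the feasible points form a
  compact subset of the interior on which the objective is continuous.\<close>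

lemma barrier_minimizer_exists:
  fixes A :: "real^'q^'m" and h :: "real^'q \<Rightarrow> real"
  assumes "compact (feasible A b)" "interior (feasible A b) \<noteq> {}"
    and h: "continuous_on (feasible A b) h" and \<kappa>: "0 < \<kappa>"
  shows "\<exists>y. is_arg_min (\<lambda>y. h y + \<kappa> * barrier A b y) (\<lambda>y. y \<in> interior (feasible A b)) y"
proof -
  let ?Y = "feasible A b"
  let ?F = "\<lambda>y. h y + \<kappa> * barrier A b y"
  obtain y0 where y0: "y0 \<in> interior ?Y" using assms(2) by blast
  then have y0': "y0 \<in> ?Y" using interior_subset by blast
  obtain hmin where hmin: "\<And>y. y \<in> ?Y \<Longrightarrow> hmin \<le> h y"
    using continuous_attains_inf[OF assms(1) _ h] y0' by blast
  have "\<exists>L. \<forall>y\<in>?Y. slack A b y i \<le> L" for i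
    using continuous_attains_sup[OF assms(1) _ continuous_on_slack] y0' by blast
  then obtain L where L: "\<And>i y. y \<in> ?Y \<Longrightarrow> slack A b y i \<le> L i" by metis
  \<comment> \<open>The term with \<open>b $ i\<close> covers the zero rows, whose slack is \<open>b $ i\<close>.\<close>
  define M where "M i = \<bar>ln (L i)\<bar> + \<bar>ln (b $ i)\<bar>" for i
  have M0: "0 \<le> M i" for i by (simp add: M_def)
  have lnM: "ln (slack A b y i) \<le> M i" if "y \<in> interior ?Y" for y i
  proof (cases "row i A = 0")
    case True
    then show ?thesis by (simp add: slack_def M_def)
  next
    case False
    then have "0 < slack A b y i" using interior_slack_pos[OF that] by blast
    then have "ln (slack A b y i) \<le> ln (L i)"
      using L[of y i] that interior_subset by (smt (verit) in_mono ln_mono)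
    then show ?thesis by (simp add: M_def)
  qed
  \<comment> \<open>A single slack below \<open>exp T\<close> makes the barrier exceed \<open>(?F y0 - hmin) / \<kappa>\<close>; taking
    \<open>\<delta>\<close> also below the slacks of \<open>y0\<close> keeps \<open>y0\<close> in the compact set.\<close>
  define T where "T = (hmin - ?F y0) / \<kappa> - sum M UNIV - 1"
  define \<delta> where "\<delta> = Min (insert (exp T) (slack A b y0 ` {i. row i A \<noteq> 0}))"
  have \<delta>0: "0 < \<delta>" unfolding \<delta>_def
    by (subst Min_gr_iff) (auto intro: interior_slack_pos[OF y0])
  have \<delta>T: "\<delta> \<le> exp T" unfolding \<delta>_def by (rule Min_le) auto
  have \<delta>s: "\<delta> \<le> slack A b y0 i" if "row i A \<noteq> 0" for i
    unfolding \<delta>_def by (rule Min_le) (use that in auto)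
  define K where "K = ?Y \<inter> (\<Inter>i\<in>{i. row i A \<noteq> 0}. {y. \<delta> \<le> slack A b y i})"
  have K: "K \<subseteq> interior ?Y"
    using \<delta>0 by (force simp: K_def intro: slack_pos_interior)
  have "compact K" unfolding K_def
    by (intro compact_Int_closed assms(1) closed_INT ballI closed_Collect_le continuous_on_const
        continuous_on_slack)
  moreover have "K \<noteq> {}" using y0' \<delta>s by (auto simp: K_def)
  moreover have "continuous_on K ?F"
  proof -
    have "isCont (barrier A b) y" if "y \<in> K" for y
      using GDERIV_barrier K that has_derivative_continuous unfolding gderiv_def by blast
    then have "continuous_on K (barrier A b)" by (simp add: continuous_at_imp_continuous_on)
    moreover have "continuous_on K h" using h by (rule continuous_on_subset) (auto simp: K_def)
    ultimately show ?thesis by (intro continuous_intros)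
  qed
  ultimately obtain y where y: "y \<in> K" "\<And>z. z \<in> K \<Longrightarrow> ?F y \<le> ?F z"
    using continuous_attains_inf[of K ?F] by blast
  have "?F y \<le> ?F z" if z: "z \<in> interior ?Y" for z
  proof (cases "z \<in> K")
    case False
    have z': "z \<in> ?Y" using z interior_subset by blast
    then obtain j where j: "row j A \<noteq> 0" "slack A b z j < \<delta>" using False by (auto simp: K_def)
    then have "ln (slack A b z j) < ln (exp T)"
      using interior_slack_pos[OF z j(1)] \<delta>T by (subst ln_less_cancel_iff) auto
    then have lnj: "ln (slack A b z j) < T" by simp
    have "(\<Sum>i\<in>UNIV. ln (slack A b z i)) = ln (slack A b z j) + (\<Sum>i\<in>UNIV-{j}. ln (slack A b z i))"
      by (simp add: sum.remove)
    also have "\<dots> \<le> T + (\<Sum>i\<in>UNIV-{j}. M i)"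
      using lnj lnM[OF z] by (intro add_mono sum_mono) auto
    also have "\<dots> \<le> T + sum M UNIV"
      by (intro add_left_mono sum_mono2) (auto simp: M0)
    finally have "- barrier A b z \<le> T + sum M UNIV" by (simp add: barrier_def slack_def)
    then have "(?F y0 - hmin) / \<kappa> \<le> barrier A b z" by (simp add: T_def diff_divide_distrib)
    then have "?F y0 - hmin \<le> \<kappa> * barrier A b z" using \<kappa> by (simp add: field_simps)
    then have "?F y0 \<le> ?F z" using hmin[OF z'] by simp
    moreover have "?F y \<le> ?F y0" using y0' \<delta>s by (intro y) (auto simp: K_def)
    ultimately show ?thesis by simp
  qed (rule y)
  then show ?thesis using y(1) K by (auto simp: is_arg_min_linorder)
qed

lemma y_star_mu_interior:
  fixes g :: "(real^'p) \<times> (real^'q) \<Rightarrow> real"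
  assumes "compact (feasible A b)" "interior (feasible A b) \<noteq> {}"
    and "continuous_on UNIV (\<lambda>y. g (x, y))" "0 < \<mu>"
  shows "y_star_mu A b g \<mu> x \<in> interior (feasible A b)"
proof -
  have "\<exists>y. is_arg_min (\<lambda>y. psi A b g \<mu> (x, y)) (\<lambda>y. y \<in> interior (feasible A b)) y"
    using barrier_minimizer_exists[OF assms(1,2) continuous_on_subset[OF assms(3)] assms(4)]
    by (simp add: psi_def)
  then have "is_arg_min (\<lambda>y. psi A b g \<mu> (x, y)) (\<lambda>y. y \<in> interior (feasible A b))
      (y_star_mu A b g \<mu> x)"
    unfolding y_star_mu_def arg_min_on_def arg_min_def by (rule someI_ex)
  then show ?thesis by (simp add: is_arg_min_def)
qed

text \<open>For \<open>\<lambda> > 0\<close> the penalized objective is again a continuous function plus a positive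
  multiple of the barrier.\<close>

lemma penalty_minimizers_nonempty:
  fixes f g :: "(real^'p) \<times> (real^'q) \<Rightarrow> real"
  assumes "compact (feasible A b)" "interior (feasible A b) \<noteq> {}"
    and "continuous_on UNIV (\<lambda>y. f (x, y))" "continuous_on UNIV (\<lambda>y. g (x, y))"
    and "0 < \<mu>" "0 < lam"
  shows "penalty_minimizers A b f g \<mu> lam x \<noteq> {}"
proof -
  let ?h = "\<lambda>y. f (x, y) + lam * g (x, y) - lam * psi_star A b g \<mu> x"
  have "continuous_on (feasible A b) ?h"
    by (intro continuous_intros continuous_on_subset[OF assms(3)] continuous_on_subset[OF assms(4)])
       simp_all
  then obtain y where "is_arg_min (\<lambda>y. ?h y + (lam * \<mu>) * barrier A b y)
      (\<lambda>y. y \<in> interior (feasible A b)) y"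
    using barrier_minimizer_exists[OF assms(1,2), of ?h "lam * \<mu>"] assms(5,6) by auto
  moreover have "penalty_lagrangian A b f g \<mu> lam x = (\<lambda>y. ?h y + (lam * \<mu>) * barrier A b y)"
    by (simp add: fun_eq_iff penalty_lagrangian_def psi_def algebra_simps)
  ultimately show ?thesis by (auto simp: penalty_minimizers_def)
qed


section \<open>Uniform local regularity\<close>

theorem proposition1:
  fixes A :: "real^'q^'m" and b :: "real^'m"
    and f g :: "(real^'p) \<times> (real^'q) \<Rightarrow> real"
    and lf0 lf1 lf2 lg0 lg1 lg2 \<rho>g \<mu> \<eta> :: real
  assumes "compact (feasible A b)"
    and "interior (feasible A b) \<noteq> {}"
    and "bdd_below (range (\<lambda>x. f (x, y_star A b g x)))"
    and "twice_continuously_differentiable f"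
    and "twice_continuously_differentiable g"
    and "lf1-lipschitz_on UNIV (gradient f)"
    and "lg1-lipschitz_on UNIV (gradient g)"
    and "\<rho>g > 0"
    and "\<And>x. strongly_convex \<rho>g (\<lambda>y. g (x, y))"
    and "lf2-lipschitz_on UNIV (hessian f)"
    and "lg2-lipschitz_on UNIV (hessian g)"
    and "\<And>x y. norm (grad_x f x y) \<le> lf0"
    and "\<And>x y. norm (grad_y f x y) \<le> lf0"
    and "\<And>x y. norm (grad_x g x y) \<le> lg0"
    and "\<mu> > 0"
    and "0 < \<eta>" and "\<eta> < 1 / 2"
  shows "\<exists>lam\<^sub>\<eta> \<rho>\<psi> \<rho>\<psi>lam l\<psi>1 l\<psi>2 l\<psi>lam1 l\<psi>lam2 lf0\<^sub>\<eta> lf1\<^sub>\<eta> lf2\<^sub>\<eta> :: real.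
    \<rho>\<psi> > 0 \<and> \<rho>\<psi>lam > 0 \<and>
    (\<forall>x. let c = y_star_mu A b g \<mu> x; T = nbhd A b \<eta> c; H = barrier_hess A b c in
      (\<forall>y\<in>T.
        \<rho>\<psi> *\<^sub>R H \<preceq>\<^sub>L hess_yy (psi A b g \<mu>) x y \<and>
        hess_yy (psi A b g \<mu>) x y \<preceq>\<^sub>L l\<psi>1 *\<^sub>R H \<and>
        opnorm_2 A b c (hess_xy (psi A b g \<mu>) x y) \<le> l\<psi>1) \<and>
      (\<forall>y1\<in>T. \<forall>y2\<in>T.
        opnorm_c A b c (hess_yy (psi A b g \<mu>) x y1 - hess_yy (psi A b g \<mu>) x y2)
          \<le> l\<psi>2 * loc_norm A b c (y1 - y2) \<and>
        opnorm_2 A b c (hess_xy (psi A b g \<mu>) x y1 - hess_xy (psi A b g \<mu>) x y2)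
          \<le> l\<psi>2 * loc_norm A b c (y1 - y2)) \<and>
      (\<forall>y\<in>T.
        dual_norm A b c (grad_y f x y) \<le> lf0\<^sub>\<eta> \<and>
        opnorm_2 A b c (hess_xy f x y) \<le> lf1\<^sub>\<eta> \<and>
        opnorm_c A b c (hess_yy f x y) \<le> lf1\<^sub>\<eta>) \<and>
      (\<forall>y1\<in>T. \<forall>y2\<in>T.
        opnorm_2 A b c (hess_xy f x y1 - hess_xy f x y2) \<le> lf2\<^sub>\<eta> * loc_norm A b c (y1 - y2) \<and>
        opnorm_c A b c (hess_yy f x y1 - hess_yy f x y2) \<le> lf2\<^sub>\<eta> * loc_norm A b c (y1 - y2)) \<and>
      (\<forall>lam\<ge>lam\<^sub>\<eta>.
        penalty_minimizers A b f g \<mu> lam x \<noteq> {} \<and>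
        (\<forall>c'\<in>penalty_minimizers A b f g \<mu> lam x.
          let T' = nbhd A b \<eta> c'; H' = barrier_hess A b c' in
          (\<forall>y\<in>T'.
            \<rho>\<psi>lam *\<^sub>R H' \<preceq>\<^sub>L hess_yy (psi A b g \<mu>) x y \<and>
            hess_yy (psi A b g \<mu>) x y \<preceq>\<^sub>L l\<psi>lam1 *\<^sub>R H' \<and>
            opnorm_2 A b c' (hess_xy (psi A b g \<mu>) x y) \<le> l\<psi>lam1) \<and>
          (\<forall>y1\<in>T'. \<forall>y2\<in>T'.
            opnorm_c A b c' (hess_yy (psi A b g \<mu>) x y1 - hess_yy (psi A b g \<mu>) x y2)
              \<le> l\<psi>lam2 * loc_norm A b c' (y1 - y2) \<and>
            opnorm_2 A b c' (hess_xy (psi A b g \<mu>) x y1 - hess_xy (psi A b g \<mu>) x y2)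
              \<le> l\<psi>lam2 * loc_norm A b c' (y1 - y2)))))"
proof -
  note compact = assms(1) and nonempty = assms(2) and f = assms(4) and g = assms(5)
  have convex: "convex_on UNIV (\<lambda>y. g (x, y))" for x
    using strongly_convex_imp_convex_on[OF assms(9)] assms(8) by simp
  have cont: "continuous_on UNIV (\<lambda>y. f (x, y))" "continuous_on UNIV (\<lambda>y. g (x, y))" for x
  proof -
    have "continuous_on UNIV f" "continuous_on UNIV g"
      using f g by (auto simp: twice_continuously_differentiable_def differentiable_imp_continuous_within
          continuous_on_eq_continuous_within)
    then show "continuous_on UNIV (\<lambda>y. f (x, y))" "continuous_on UNIV (\<lambda>y. g (x, y))"
      by (auto intro!: continuous_intros intro: continuous_on_compose2)
  qed
  obtain \<kappa> where \<kappa>: "0 < \<kappa>"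
    "\<forall>c\<in>interior (feasible A b). \<forall>u. norm u \<le> \<kappa> * loc_norm A b c u"
    using norm_le_loc_norm[OF compact nonempty] by blast
  have centre: "barrier_centre A b c \<kappa>" if "c \<in> interior (feasible A b)" for c
    using that \<kappa> compact by unfold_locales auto
  define R where "R = 4 / 9 * \<mu>"
  define L1 where "L1 = max (lg1 * \<kappa>\<^sup>2 + 4 * \<mu>) (lg1 * \<kappa>)"
  define L2 where "L2 = max (lg2 * \<kappa>^3 + 16 * \<mu>) (lg2 * \<kappa>\<^sup>2)"
  define F0 where "F0 = lf0 * \<kappa>"
  define F1 where "F1 = max (lf1 * \<kappa>\<^sup>2) (lf1 * \<kappa>)"
  define F2 where "F2 = max (lf2 * \<kappa>^3) (lf2 * \<kappa>\<^sup>2)"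
  note const_defs = R_def L1_def L2_def F0_def F1_def F2_def
  have \<eta>: "\<eta> \<le> 1 / 2" using assms(17) by simp
  have weaken: "r \<le> L * d" if "r \<le> K * d" "K \<le> L" "0 \<le> d" for r K L d :: real
    using that by (meson mult_right_mono order_trans)
  have psi1: "R *\<^sub>R barrier_hess A b c \<preceq>\<^sub>L hess_yy (psi A b g \<mu>) x y \<and>
      hess_yy (psi A b g \<mu>) x y \<preceq>\<^sub>L L1 *\<^sub>R barrier_hess A b c \<and>
      opnorm_2 A b c (hess_xy (psi A b g \<mu>) x y) \<le> L1"
    if c: "c \<in> interior (feasible A b)" and y: "y \<in> nbhd A b \<eta> c" for c x y
  proof -
    interpret barrier_centre A b c \<kappa> by (rule centre[OF c])
    have int: "y \<in> interior (feasible A b)" using y by (simp add: nbhd_def)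
    show ?thesis
      unfolding hess_xy_psi[OF g int]
      using psi_hess_yy_bounds[OF g assms(7) convex assms(15) \<eta> y]
        opnorm_hess_blocks_le(2)[OF g assms(7), of x y]
      by (auto simp: const_defs le_max_iff_disj)
  qed
  have psi2: "opnorm_c A b c (hess_yy (psi A b g \<mu>) x y1 - hess_yy (psi A b g \<mu>) x y2)
        \<le> L2 * loc_norm A b c (y1 - y2) \<and>
      opnorm_2 A b c (hess_xy (psi A b g \<mu>) x y1 - hess_xy (psi A b g \<mu>) x y2)
        \<le> L2 * loc_norm A b c (y1 - y2)"
    if c: "c \<in> interior (feasible A b)" and y: "y1 \<in> nbhd A b \<eta> c" "y2 \<in> nbhd A b \<eta> c"
    for c x y1 y2
  proof -
    interpret barrier_centre A b c \<kappa> by (rule centre[OF c])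
    have int: "y1 \<in> interior (feasible A b)" "y2 \<in> interior (feasible A b)"
      using y by (auto simp: nbhd_def)
    show ?thesis
      unfolding hess_xy_psi[OF g int(1)] hess_xy_psi[OF g int(2)]
      using weaken[OF psi_hess_yy_lipschitz[OF g assms(11,15) \<eta> y] _ N_nonneg]
        weaken[OF opnorm_hess_blocks_lipschitz(2)[OF g assms(11)] _ N_nonneg]
      by (simp add: const_defs)
  qed
  have f1: "dual_norm A b c (grad_y f x y) \<le> F0 \<and> opnorm_2 A b c (hess_xy f x y) \<le> F1 \<and>
      opnorm_c A b c (hess_yy f x y) \<le> F1"
    if c: "c \<in> interior (feasible A b)" for c x y
  proof -
    interpret barrier_centre A b c \<kappa> by (rule centre[OF c])
    have "norm (grad_y f x y) * \<kappa> \<le> lf0 * \<kappa>"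
      using assms(13) \<kappa>(1) by (intro mult_right_mono) auto
    then show ?thesis
      using dual_norm_le_norm[of "grad_y f x y"] opnorm_hess_blocks_le[OF f assms(6), of x y]
      by (auto simp: const_defs le_max_iff_disj)
  qed
  have f2: "opnorm_2 A b c (hess_xy f x y1 - hess_xy f x y2) \<le> F2 * loc_norm A b c (y1 - y2) \<and>
      opnorm_c A b c (hess_yy f x y1 - hess_yy f x y2) \<le> F2 * loc_norm A b c (y1 - y2)"
    if c: "c \<in> interior (feasible A b)" for c x y1 y2
  proof -
    interpret barrier_centre A b c \<kappa> by (rule centre[OF c])
    show ?thesis
      using weaken[OF opnorm_hess_blocks_lipschitz(2)[OF f assms(10)] _ N_nonneg]
        weaken[OF opnorm_hess_blocks_lipschitz(1)[OF f assms(10)] _ N_nonneg]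
      by (simp add: const_defs)
  qed
  have c: "y_star_mu A b g \<mu> x \<in> interior (feasible A b)" for x
    by (rule y_star_mu_interior[OF compact nonempty cont(2) assms(15)])
  have c': "c' \<in> interior (feasible A b)" if "c' \<in> penalty_minimizers A b f g \<mu> lam x" for c' lam x
    using that by (simp add: penalty_minimizers_def is_arg_min_def)
  have ne: "penalty_minimizers A b f g \<mu> lam x \<noteq> {}" if "1 \<le> lam" for lam x
    using that by (intro penalty_minimizers_nonempty compact nonempty cont assms(15)) simp
  show ?thesis
    unfolding Let_def
  proof (rule exI[of _ 1], rule exI[of _ R], rule exI[of _ R],
      rule exI[of _ L1], rule exI[of _ L2], rule exI[of _ L1], rule exI[of _ L2],
      rule exI[of _ F0], rule exI[of _ F1], rule exI[of _ F2], intro conjI allI impI ballI)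
    show "0 < R" "0 < R" using assms(15) by (simp_all add: R_def)
  qed (simp_all add: psi1[OF c] psi2[OF c] f1[OF c] f2[OF c] psi1[OF c'] psi2[OF c'] ne)
qed

end
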